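(* Let $G$ be a conjugacy separable, hyperbolic group. Then each virtually torsion-free subgroup of the outer automorphism group $\mathrm{Out}(G)$ of $G$ is residually finite.
   Context: A geodesic metric space $X$ is $\delta$-hyperbolic ($\delta\ge 0$) if for every triangle in $X$ with geodesic sides, each side is contained in the $\delta$-neighbourhood of the union of the two other sides. A finitely generated group $G$ is hyperbolic if, for a finite generating set $S$ of $G$ closed under inverses, the Cayley graph $X(G,S)$ with the word metric is $\delta$-hyperbolic for some $\delta\ge 0$. A group $G$ is conjugacy separable if any two non-conjugate elements of $G$ have non-conjugate images in some finite quotient of $G$. $\mathrm{Out}(G)=\mathrm{Aut}(G)/\mathrm{Inn}(G)$, where $\mathrm{Inn}(G)$ is the group of inner automorphisms. A group is virtually torsion-free if it has a torsion-free subgroup of finite index. A group is residually finite if the intersection of its finite-index subgroups is trivial. *)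

theory Defs
  imports "HOL-Algebra.Generated_Groups" "HOL-Algebra.Bij" "HOL-Analysis.Abstract_Metric_Spaces"
begin

section \<open>Geodesic and hyperbolic metric spaces\<close>

definition geodesic_segment ::
    "'p set \<Rightarrow> ('p \<Rightarrow> 'p \<Rightarrow> real) \<Rightarrow> 'p \<Rightarrow> 'p \<Rightarrow> 'p set \<Rightarrow> bool" where
  "geodesic_segment M d x y A \<longleftrightarrow>
     (\<exists>c. c \<in> {0..d x y} \<rightarrow> M \<and> c 0 = x \<and> c (d x y) = y \<and>
          (\<forall>s\<in>{0..d x y}. \<forall>t\<in>{0..d x y}. d (c s) (c t) = \<bar>s - t\<bar>) \<and>
          A = c ` {0..d x y})"

definition geodesic_metric_space :: "'p set \<Rightarrow> ('p \<Rightarrow> 'p \<Rightarrow> real) \<Rightarrow> bool" where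
  "geodesic_metric_space M d \<longleftrightarrow>
     Metric_space M d \<and> (\<forall>x\<in>M. \<forall>y\<in>M. \<exists>A. geodesic_segment M d x y A)"

(* Neighbourhoods are closed, so that delta = 0 is meaningful (trees).  Since x, y, z range
   over all triples, it suffices to state the condition for the side joining x and y. *)
definition hyperbolic_space :: "real \<Rightarrow> 'p set \<Rightarrow> ('p \<Rightarrow> 'p \<Rightarrow> real) \<Rightarrow> bool" where
  "hyperbolic_space \<delta> M d \<longleftrightarrow>
     0 \<le> \<delta> \<and> geodesic_metric_space M d \<and>
     (\<forall>x\<in>M. \<forall>y\<in>M. \<forall>z\<in>M. \<forall>A B C.
        geodesic_segment M d x y A \<longrightarrow> geodesic_segment M d y z B \<longrightarrow>
        geodesic_segment M d x z C \<longrightarrow>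
        (\<forall>p\<in>A. \<exists>q\<in>B \<union> C. d p q \<le> \<delta>))"

section \<open>Cayley graphs and hyperbolic groups\<close>

definition word_length :: "('a, 'b) monoid_scheme \<Rightarrow> 'a set \<Rightarrow> 'a \<Rightarrow> nat" where
  "word_length G S g =
     (LEAST n. \<exists>ws. set ws \<subseteq> S \<and> length ws = n \<and> foldr (\<otimes>\<^bsub>G\<^esub>) ws \<one>\<^bsub>G\<^esub> = g)"

definition word_dist :: "('a, 'b) monoid_scheme \<Rightarrow> 'a set \<Rightarrow> 'a \<Rightarrow> 'a \<Rightarrow> nat" where
  "word_dist G S g h = word_length G S (inv\<^bsub>G\<^esub> g \<otimes>\<^bsub>G\<^esub> h)"

definition supp :: "('a \<Rightarrow> real) \<Rightarrow> 'a set" where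
  "supp p = {g. p g \<noteq> 0}"

(* The Cayley graph as a metric graph: the geometric realisation of the graph with vertex set G
   in which distinct u, v are joined by a single edge iff v = u s for some s in S.  (S is closed
   under inverses; the edges (u, s) and (u s, inv s) are identified, and there are no loops.)
   A point is given by its barycentric coordinates: a vertex u is the indicator function of {u},
   and the point of the edge {u, v} at distance t from u takes the value 1 - t at u and t at v. *)
definition cayley_graph :: "('a, 'b) monoid_scheme \<Rightarrow> 'a set \<Rightarrow> ('a \<Rightarrow> real) set" where
  "cayley_graph G S =
     {p. (\<forall>g. 0 \<le> p g) \<and> (\<Sum>g\<in>supp p. p g) = 1 \<and>
         (\<exists>u\<in>carrier G. \<exists>v\<in>carrier G.
            (u = v \<or> inv\<^bsub>G\<^esub> u \<otimes>\<^bsub>G\<^esub> v \<in> S) \<and> supp p \<subseteq> {u, v})}"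

(* The length metric extending the word metric, every edge having length 1.  If one support
   contains the other, then the two points lie on a common closed edge, and their distance is
   measured along it.  Otherwise a shortest path from p to q leaves p through an end point u of
   its edge (at distance 1 - p u from p) and reaches q through an end point v of its edge.
   The value 0 off the graph is a convention: Metric_space demands nonnegativity and symmetry
   of the distance function on the whole type. *)
definition cayley_dist ::
    "('a, 'b) monoid_scheme \<Rightarrow> 'a set \<Rightarrow> ('a \<Rightarrow> real) \<Rightarrow> ('a \<Rightarrow> real) \<Rightarrow> real" where
  "cayley_dist G S p q =
     (if p \<notin> cayley_graph G S \<or> q \<notin> cayley_graph G S then 0
      else if supp p \<subseteq> supp q \<or> supp q \<subseteq> supp p
      then (\<Sum>g\<in>supp p \<union> supp q. \<bar>p g - q g\<bar>) / 2
      else Min ((\<lambda>(u, v). (1 - p u) + real (word_dist G S u v) + (1 - q v)) ` (supp p \<times> supp q)))"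

definition symmetric_generating_set :: "('a, 'b) monoid_scheme \<Rightarrow> 'a set \<Rightarrow> bool" where
  "symmetric_generating_set G S \<longleftrightarrow>
     S \<subseteq> carrier G \<and> (\<forall>s\<in>S. inv\<^bsub>G\<^esub> s \<in> S) \<and> generate G S = carrier G"

definition hyperbolic_group :: "('a, 'b) monoid_scheme \<Rightarrow> bool" where
  "hyperbolic_group G \<longleftrightarrow>
     group G \<and>
     (\<exists>S. finite S \<and> symmetric_generating_set G S \<and>
          (\<exists>\<delta>. hyperbolic_space \<delta> (cayley_graph G S) (cayley_dist G S)))"

section \<open>Separability properties and the outer automorphism group\<close>

definition conjugate :: "('a, 'b) monoid_scheme \<Rightarrow> 'a \<Rightarrow> 'a \<Rightarrow> bool" where
  "conjugate G x y \<longleftrightarrow> (\<exists>g\<in>carrier G. y = g \<otimes>\<^bsub>G\<^esub> x \<otimes>\<^bsub>G\<^esub> inv\<^bsub>G\<^esub> g)"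

definition conjugacy_separable :: "('a, 'b) monoid_scheme \<Rightarrow> bool" where
  "conjugacy_separable G \<longleftrightarrow>
     (\<forall>x\<in>carrier G. \<forall>y\<in>carrier G. \<not> conjugate G x y \<longrightarrow>
        (\<exists>N. N \<lhd> G \<and> finite (carrier (G Mod N)) \<and>
             \<not> conjugate (G Mod N) (N #>\<^bsub>G\<^esub> x) (N #>\<^bsub>G\<^esub> y)))"

definition finite_index_subgroup :: "'a set \<Rightarrow> ('a, 'b) monoid_scheme \<Rightarrow> bool" where
  "finite_index_subgroup H G \<longleftrightarrow> subgroup H G \<and> finite (rcosets\<^bsub>G\<^esub> H)"

definition residually_finite :: "('a, 'b) monoid_scheme \<Rightarrow> bool" where
  "residually_finite G \<longleftrightarrow> \<Inter> {H. finite_index_subgroup H G} = {\<one>\<^bsub>G\<^esub>}"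

definition torsion_free :: "('a, 'b) monoid_scheme \<Rightarrow> bool" where
  "torsion_free G \<longleftrightarrow>
     (\<forall>x\<in>carrier G. \<forall>n::nat. 0 < n \<longrightarrow> x [^]\<^bsub>G\<^esub> n = \<one>\<^bsub>G\<^esub> \<longrightarrow> x = \<one>\<^bsub>G\<^esub>)"

definition virtually_torsion_free :: "('a, 'b) monoid_scheme \<Rightarrow> bool" where
  "virtually_torsion_free G \<longleftrightarrow>
     (\<exists>H. finite_index_subgroup H G \<and> torsion_free (G\<lparr>carrier := H\<rparr>))"

definition Inn :: "('a, 'b) monoid_scheme \<Rightarrow> ('a \<Rightarrow> 'a) set" where
  "Inn G = (\<lambda>g. \<lambda>x\<in>carrier G. g \<otimes>\<^bsub>G\<^esub> x \<otimes>\<^bsub>G\<^esub> inv\<^bsub>G\<^esub> g) ` carrier G"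

definition Out :: "('a, 'b) monoid_scheme \<Rightarrow> ('a \<Rightarrow> 'a) set monoid" where
  "Out G = AutoGroup G Mod Inn G"

end

(* For an automorphism f taking every element to a conjugate, the images of the generators and of
   their pairwise products have bounded displacement on the Cayley graph.  As for elliptic isometries
   of a tree, hyperbolicity then yields one point moved a bounded distance by all f s, so after
   composition with an inner automorphism f maps the generators into a fixed finite ball.  Hence
   these automorphisms have finite image in Out G, and a torsion-free subgroup of Out G contains none
   of them but the identity.  Any other automorphism takes some g to a non-conjugate element, which
   remains non-conjugate to g in a finite quotient Q; since there are only finitely many homomorphisms
   from G to Q, this is detected by a finite-index subgroup of Out G. *)
theory Submission
  imports Defs
begin

section \<open>Isometries of spaces with the four-point property\<close>

lemma geodesic_segment_dist:
  assumes "Metric_space M d" "geodesic_segment M d x y A" "p \<in> A"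
  shows "p \<in> M" "d x p + d p y = d x y"
proof -
  interpret Metric_space M d by fact
  obtain c t where c: "c \<in> {0..d x y} \<rightarrow> M" "c 0 = x" "c (d x y) = y"
      "\<forall>s\<in>{0..d x y}. \<forall>t\<in>{0..d x y}. d (c s) (c t) = \<bar>s - t\<bar>"
    and t: "t \<in> {0..d x y}" "p = c t"
    using assms(2,3) unfolding geodesic_segment_def by auto
  show "p \<in> M" using c t by auto
  have "d (c 0) (c t) = \<bar>0 - t\<bar>" "d (c t) (c (d x y)) = \<bar>t - d x y\<bar>"
    using c(4) t(1) by auto
  then show "d x p + d p y = d x y" using c t by auto
qed

lemma geodesic_segment_ends:
  assumes "Metric_space M d" "geodesic_segment M d x y A"
  shows "x \<in> A" "y \<in> A"
proof -
  interpret Metric_space M d by fact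
  obtain c where c: "c 0 = x" "c (d x y) = y" "A = c ` {0..d x y}"
    using assms(2) unfolding geodesic_segment_def by blast
  have "c 0 \<in> A" "c (d x y) \<in> A" using c(3) by auto
  then show "x \<in> A" "y \<in> A" using c(1,2) by simp_all
qed

lemma hyperbolic_spaceD:
  assumes "hyperbolic_space \<delta> M d"
  shows "Metric_space M d" "0 \<le> \<delta>"
    "x \<in> M \<Longrightarrow> y \<in> M \<Longrightarrow> \<exists>A. geodesic_segment M d x y A"
    "\<lbrakk>x \<in> M; y \<in> M; z \<in> M; geodesic_segment M d x y A; geodesic_segment M d y z B;
      geodesic_segment M d x z C; p \<in> A\<rbrakk> \<Longrightarrow> \<exists>q\<in>B \<union> C. d p q \<le> \<delta>"
  using assms unfolding hyperbolic_space_def geodesic_metric_space_def by simp_all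

(* The point p moves along the side xy until the other sides swap roles; it approximates the
   centre of the triangle xyw, so its distance to w is the Gromov product of x and y at w. *)
lemma hyperbolic_space_center:
  assumes hyp: "hyperbolic_space \<delta> M d" and xyw: "x \<in> M" "y \<in> M" "w \<in> M"
    and A: "geodesic_segment M d x y A"
  shows "\<exists>p\<in>A. 2 * d w p \<le> d x w + d y w - d x y + 4 * \<delta> + 2"
proof -
  note M = hyperbolic_spaceD(1)[OF hyp] and \<delta> = hyperbolic_spaceD(2)[OF hyp]
  interpret Metric_space M d by fact
  obtain B where B: "geodesic_segment M d y w B"
    using hyperbolic_spaceD(3)[OF hyp xyw(2,3)] by blast
  obtain C where C: "geodesic_segment M d x w C"
    using hyperbolic_spaceD(3)[OF hyp xyw(1,3)] by blast
  have thin: "\<exists>q\<in>B \<union> C. d p q \<le> \<delta>" if "p \<in> A" for p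
    using hyperbolic_spaceD(4)[OF hyp xyw A B C that] .
  obtain c where c: "c 0 = x" "c (d x y) = y"
      "\<forall>s\<in>{0..d x y}. \<forall>t\<in>{0..d x y}. d (c s) (c t) = \<bar>s - t\<bar>" "A = c ` {0..d x y}"
    using A unfolding geodesic_segment_def by auto
  \<comment> \<open>The side is sampled at unit spacing, and the \<open>min\<close> keeps
    \<open>pt k\<close> at \<open>y\<close> once \<open>k\<close> exceeds the length
    \<open>d x y\<close>. Consecutive samples are at most 1 apart, which is the extra 1 in the bound
    \<delta> + 1 for the distance to \<open>B\<close>.\<close>
  define pt where "pt k = c (min (real k) (d x y))" for k
  have ptA: "pt k \<in> A" for k using c(4) by (auto simp: pt_def)
  have pt_step: "d (pt k) (pt (Suc k)) \<le> 1" for k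
  proof -
    have "d (pt k) (pt (Suc k)) = \<bar>min (real k) (d x y) - min (real (Suc k)) (d x y)\<bar>"
      unfolding pt_def using c(3) by auto
    then show ?thesis by auto
  qed
  \<comment> \<open>Every sample is close to \<open>B\<close> or to \<open>C\<close>. The walk
    starts on \<open>C\<close>; either it leaves the neighbourhood of \<open>C\<close> at some step,
    where both sides are close, or it stays near \<open>C\<close> up to \<open>y\<close>, which
    belongs to \<open>B\<close>.\<close>
  define P where "P k \<longleftrightarrow> (\<exists>q\<in>C. d (pt k) q \<le> \<delta>)" for k
  have "P 0"
    using geodesic_segment_ends(1)[OF M C] c(1) \<delta> xyw unfolding P_def pt_def
    by (intro bexI[of _ x]) auto
  have "\<exists>p\<in>A. \<exists>q\<in>C. \<exists>r\<in>B. d p q \<le> \<delta> \<and> d p r \<le> \<delta> + 1"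
  proof (cases "\<forall>k. P k")
    case True
    obtain k where k: "d x y \<le> real k" using real_arch_simple by blast
    then have "pt k = y" using c(2) by (simp add: pt_def)
    moreover have "d y y \<le> \<delta> + 1" using \<delta> xyw by simp
    moreover obtain q where "q \<in> C" "d (pt k) q \<le> \<delta>" using True unfolding P_def by blast
    ultimately show ?thesis
      using ptA[of k] geodesic_segment_ends(1)[OF M B] by auto
  next
    case False
    then obtain k where k: "P k" "\<not> P (Suc k)"
      using \<open>P 0\<close> by (metis nat_induct)
    then obtain r where r: "r \<in> B" "d (pt (Suc k)) r \<le> \<delta>"
      using thin[OF ptA[of "Suc k"]] unfolding P_def by auto
    have "d (pt k) r \<le> d (pt k) (pt (Suc k)) + d (pt (Suc k)) r"
      using geodesic_segment_dist(1)[OF M A] ptA geodesic_segment_dist(1)[OF M B] r(1)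
      by (intro triangle) auto
    then have "d (pt k) r \<le> \<delta> + 1" using pt_step[of k] r(2) by linarith
    then show ?thesis using k(1) r(1) ptA[of k] unfolding P_def by blast
  qed
  then obtain p q r where pqr: "p \<in> A" "q \<in> C" "r \<in> B" "d p q \<le> \<delta>" "d p r \<le> \<delta> + 1" by blast
  have inM: "p \<in> M" "q \<in> M" "r \<in> M"
    using geodesic_segment_dist(1)[OF M A] geodesic_segment_dist(1)[OF M B]
      geodesic_segment_dist(1)[OF M C] pqr by blast+
  have on: "d x p + d p y = d x y" "d x q + d q w = d x w" "d y r + d r w = d y w"
    using geodesic_segment_dist(2)[OF M A] geodesic_segment_dist(2)[OF M B]
      geodesic_segment_dist(2)[OF M C] pqr by blast+
  \<comment> \<open>The two detours through \<open>q\<close> lose \<delta> each and the two through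
    \<open>r\<close> lose \<delta> + 1 each, together \<open>4 * \<delta> + 2\<close>.\<close>
  have "d x p \<le> d x q + d q p" "d p y \<le> d p r + d r y" "d w p \<le> d w q + d q p" "d w p \<le> d w r + d r p"
    using inM xyw by (auto intro: triangle)
  then have "2 * d w p \<le> d x w + d y w - d x y + 4 * \<delta> + 2"
    using on pqr(4,5) commute[of q p] commute[of r p] commute[of r y] commute[of w q] commute[of w r]
    by linarith
  then show ?thesis using pqr(1) by blast
qed

text \<open>The centre \<open>p\<close> of the triangle \<open>x\<close>, \<open>y\<close>,
  \<open>w\<close> lies on the side joining \<open>x\<close> and \<open>y\<close>, so thinness of
  the triangle \<open>x\<close>, \<open>y\<close>, \<open>z\<close> gives a point \<open>q\<close>
  near \<open>p\<close> on another side. Going from \<open>w\<close> to \<open>z\<close> through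
  \<open>q\<close> yields the inequality; the side containing \<open>q\<close> decides which term of
  the maximum occurs.\<close>

lemma hyperbolic_space_four_point:
  assumes hyp: "hyperbolic_space \<delta> M d" and xyzw: "x \<in> M" "y \<in> M" "z \<in> M" "w \<in> M"
  shows "d x y + d z w \<le> max (d x z + d y w) (d x w + d y z) + (6 * \<delta> + 2)"
proof -
  note M = hyperbolic_spaceD(1)[OF hyp]
  interpret Metric_space M d by fact
  obtain A where A: "geodesic_segment M d x y A"
    using hyperbolic_spaceD(3)[OF hyp xyzw(1,2)] by blast
  obtain B where B: "geodesic_segment M d y z B"
    using hyperbolic_spaceD(3)[OF hyp xyzw(2,3)] by blast
  obtain C where C: "geodesic_segment M d x z C"
    using hyperbolic_spaceD(3)[OF hyp xyzw(1,3)] by blast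
  obtain p where p: "p \<in> A" "2 * d w p \<le> d x w + d y w - d x y + 4 * \<delta> + 2"
    using hyperbolic_space_center[OF hyp xyzw(1,2,4) A] by blast
  obtain q where q: "q \<in> B \<union> C" "d p q \<le> \<delta>"
    using hyperbolic_spaceD(4)[OF hyp xyzw(1-3) A B C p(1)] by blast
  have pM: "p \<in> M" using geodesic_segment_dist(1)[OF M A p(1)] .
  have qM: "q \<in> M" using q(1) geodesic_segment_dist(1)[OF M] B C by blast
  have tri: "d w q \<le> d w p + d p q" "d w z \<le> d w q + d q z" "d x w \<le> d x q + d q w" "d y w \<le> d y q + d q w"
    using pM qM xyzw by (auto intro: triangle)
  from q(1) show ?thesis
  proof
    assume "q \<in> B"
    from geodesic_segment_dist(2)[OF M B this] show ?thesis
      using tri p(2) q(2) commute[of w q] commute[of w z] by linarith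
  next
    assume "q \<in> C"
    from geodesic_segment_dist(2)[OF M C this] show ?thesis
      using tri p(2) q(2) commute[of w q] commute[of w z] by linarith
  qed
qed

text \<open>Here \<delta> is the constant of the four-point inequality, not of thin triangles.
  Midpoints up to an error of 1 replace geodesics, so that the vertex set of a Cayley graph, where
  distances are integers, is an instance.\<close>

locale four_point_space = Metric_space M d
  for M :: "'p set" and d :: "'p \<Rightarrow> 'p \<Rightarrow> real" +
  fixes \<delta> :: real
  assumes four_point: "\<lbrakk>x \<in> M; y \<in> M; z \<in> M; w \<in> M\<rbrakk> \<Longrightarrow>
      d x y + d z w \<le> max (d x z + d y w) (d x w + d y z) + \<delta>"
    and rough_midpoint: "\<lbrakk>x \<in> M; y \<in> M\<rbrakk> \<Longrightarrow>
      \<exists>m\<in>M. d x m \<le> d x y / 2 + 1 \<and> d m y \<le> d x y / 2 + 1"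
begin

section \<open>Displacement of isometries, modelled on trees\<close>

definition isometric :: "('p \<Rightarrow> 'p) \<Rightarrow> bool" where
  "isometric f \<longleftrightarrow> f \<in> M \<rightarrow> M \<and> (\<forall>x\<in>M. \<forall>y\<in>M. d (f x) (f y) = d x y)"

lemma isometric_in [simp]: "isometric f \<Longrightarrow> x \<in> M \<Longrightarrow> f x \<in> M"
  unfolding isometric_def by auto

lemma isometric_dist: "isometric f \<Longrightarrow> x \<in> M \<Longrightarrow> y \<in> M \<Longrightarrow> d (f x) (f y) = d x y"
  unfolding isometric_def by auto

lemma isometric_comp: "isometric f \<Longrightarrow> isometric g \<Longrightarrow> isometric (f \<circ> g)"
  unfolding isometric_def by (auto simp: Pi_iff)

lemma \<delta>_nonneg: "x \<in> M \<Longrightarrow> 0 \<le> \<delta>"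
  using four_point[of x x x x] by simp

text \<open>In a tree an isometry with a fixed point fixes the midpoint of \<open>x\<close> and
  \<open>f x\<close>. The first four-point inequality bounds \<open>d m p\<close> by about
  \<open>d p x - d x (f x) / 2\<close>; the second turns this into a bound for
  \<open>d m (f m)\<close>.\<close>

lemma midpoint_displacement:
  assumes f: "isometric f" and p: "p \<in> M" "d p (f p) \<le> L" and x: "x \<in> M" and m: "m \<in> M"
    "d x m \<le> d x (f x) / 2 + 1" "d m (f x) \<le> d x (f x) / 2 + 1"
  shows "d m (f m) \<le> 3 * L + 2 + 2 * \<delta>"
proof -
  note in_M = p(1) x m(1) f isometric_in
  have "d (f p) (f x) = d p x" "d (f p) (f m) = d p m" "d (f x) (f m) = d x m"
    using in_M by (auto simp: isometric_dist)
  moreover have "d p (f x) \<le> d p (f p) + d (f p) (f x)" "d (f p) (f x) \<le> d (f p) p + d p (f x)"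
      "d p (f m) \<le> d p (f p) + d (f p) (f m)"
    using in_M by (auto intro: triangle)
  moreover have "d m p + d x (f x) \<le> max (d m x + d p (f x)) (d m (f x) + d p x) + \<delta>"
      "d m (f m) + d (f x) p \<le> max (d m (f x) + d (f m) p) (d m p + d (f m) (f x)) + \<delta>"
    using in_M by (auto intro!: four_point)
  ultimately show ?thesis
    using p(2) m(2,3) commute[of m x] commute[of m p] commute[of "f p" p] commute[of "f m" p]
      commute[of "f x" "f m"] commute[of "f x" p]
    by linarith
qed

text \<open>The almost fixed point \<open>p\<close> has nearly the same distance from
  \<open>x\<close>, \<open>f x\<close> and \<open>f (f x)\<close>, so these distances cancel in the
  four-point inequality. A translation of a tree doubles the displacement of points on its axis; the
  bound serves to exclude such behaviour.\<close>

lemma square_displacement: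
  assumes f: "isometric f" and p: "p \<in> M" "d p (f p) \<le> L" and x: "x \<in> M"
  shows "d x (f (f x)) \<le> d x (f x) + 3 * L + \<delta>"
proof -
  note in_M = p(1) x f isometric_in
  have "d (f p) (f x) = d p x" "d (f p) (f (f x)) = d p (f x)" "d (f x) (f (f x)) = d x (f x)"
    using in_M by (auto simp: isometric_dist)
  moreover have "d p (f x) \<le> d p (f p) + d (f p) (f x)" "d (f p) (f x) \<le> d (f p) p + d p (f x)"
      "d p (f (f x)) \<le> d p (f p) + d (f p) (f (f x))"
    using in_M by (auto intro: triangle)
  moreover have "d x (f (f x)) + d (f x) p \<le> max (d x (f x) + d (f (f x)) p) (d x p + d (f (f x)) (f x)) + \<delta>"
    using in_M by (auto intro!: four_point)
  ultimately show ?thesis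
    using p(2) commute[of x p] commute[of "f p" p] commute[of "f (f x)" p]
      commute[of "f x" "f (f x)"] commute[of "f x" p]
    by linarith
qed

(* In a tree: if a, b and their product have fixed points and the fixed point set of a is at least
   as far from x as that of b, then b fixes the projection m of x to the fixed point set of a,
   since otherwise the product of b and a would translate m. *)
lemma pair_displacement:
  assumes a: "isometric a" and b: "isometric b"
    and p: "p \<in> M" "d p (a p) \<le> L" and q: "q \<in> M" "d q (b q) \<le> L"
    and r: "r \<in> M" "d r (b (a r)) \<le> L"
    and x: "x \<in> M" "d x (b x) \<le> d x (a x)"
    and m: "m \<in> M" "d x m \<le> d x (a x) / 2 + 1" "d m (a x) \<le> d x (a x) / 2 + 1"
  shows "d m (b m) \<le> 21 * L + 32 * \<delta> + 32"
proof -
  \<comment> \<open>The bound of \<open>midpoint_displacement\<close>, used both for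
    \<open>a\<close> at \<open>m\<close> and for \<open>b\<close> at \<open>n\<close>.\<close>
  define C where "C = 3 * L + 2 + 2 * \<delta>"
  have L: "0 \<le> L" using p(2) nonneg order_trans by blast
  have \<delta>: "0 \<le> \<delta>" using \<delta>_nonneg x by blast
  define D where "D = d x (a x)"
  define E where "E = d m (b m)"
  have E: "0 \<le> E" by (simp add: E_def)
  have C: "0 \<le> C" using L \<delta> by (simp add: C_def)
  \<comment> \<open>As a rough midpoint of \<open>m\<close> and \<open>b m\<close>, the point
    \<open>n\<close> is almost fixed by \<open>b\<close>.\<close>
  obtain n where n: "n \<in> M" "d m n \<le> E / 2 + 1" "d n (b m) \<le> E / 2 + 1"
    using rough_midpoint[of m "b m"] m(1) b unfolding E_def by auto
  have am: "d m (a m) \<le> C"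
    unfolding C_def by (rule midpoint_displacement[OF a p x(1) m])
  have bn: "d n (b n) \<le> C"
    unfolding C_def using midpoint_displacement[OF b q m(1) n(1)] n(2,3) by (simp add: E_def)
  note in_M = a b x(1) m(1) n(1) isometric_in
  have iso: "d (b n) (b x) = d n x" "d (b m) (b x) = d m x" "d (b m) (b (a m)) = d m (a m)"
      "d (b (a m)) (b (a (b m))) = E" "d (b x) (b (a x)) = D" "d (b m) (b (a x)) = d m (a x)"
      "d (b (a x)) (b (a (b m))) = d x (b m)"
      "d (b (a (b m))) (b (a (b (a m)))) = d m (a m)"
    using in_M by (auto simp: isometric_dist E_def D_def)
  have ma: "d x m \<le> D / 2 + 1" "d m (a x) \<le> D / 2 + 1" "d x (b x) \<le> D"
    using m(2,3) x(2) by (auto simp: D_def)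
  \<comment> \<open>This is where \<open>b\<close> moving \<open>x\<close> no further than
    \<open>a\<close> enters: \<open>n\<close>, almost fixed by \<open>b\<close>, is about as far
    from \<open>b x\<close> as from \<open>x\<close>, and these two points are at most
    \<open>D\<close> apart.\<close>
  have nx: "d n x \<le> D / 2 + 2 + 2 * \<delta> + C"
  proof -
    have "d m (b m) + d x n \<le> max (d m x + d (b m) n) (d m n + d (b m) x) + \<delta>"
      "d x (b m) + d (b x) n \<le> max (d x (b x) + d (b m) n) (d x n + d (b m) (b x)) + \<delta>"
      using in_M by (auto intro!: four_point)
    moreover have "d (b n) (b x) \<le> d (b n) n + d n (b x)"
      using in_M by (auto intro: triangle)
    ultimately show ?thesis
      using iso(1,2) ma n(2,3) bn \<delta> C E E_def commute[of x n] commute[of m x] commute[of "b m" n]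
        commute[of "b m" x] commute[of "b x" n] commute[of "b n" n]
      by linarith
  qed
  have "d m (b m) \<le> d m n + d n (b m)" using in_M by (auto intro: triangle)
  then have mn: "E / 2 - 1 \<le> d m n" "E / 2 - 1 \<le> d n (b m)"
    using n(2,3) E_def by linarith+
  have xbm: "d x (b m) \<le> D / 2 + E / 2 + C + 3 * \<delta> + 3"
  proof -
    have "d x (b m) + d m n \<le> max (d x m + d (b m) n) (d x n + d (b m) m) + \<delta>"
      using in_M by (auto intro!: four_point)
    then show ?thesis
      using nx ma mn n(3) \<delta> C E E_def commute[of x n] commute[of "b m" n] commute[of "b m" m]
      by linarith
  qed
  have bxm: "d (b x) m \<le> D / 2 + E / 2 + 2 * C + 3 * \<delta> + 3"
  proof -
    have "d (b x) m + d (b m) n \<le> max (d (b x) (b m) + d m n) (d (b x) n + d m (b m)) + \<delta>"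
      using in_M by (auto intro!: four_point)
    moreover have "d n (b x) \<le> d n (b n) + d (b n) (b x)"
      using in_M by (auto intro: triangle)
    ultimately show ?thesis
      using iso(1,2) nx ma mn n(2) bn \<delta> C E E_def commute[of "b x" n] commute[of "b m" n]
        commute[of "b x" "b m"] commute[of m x]
      by linarith
  qed
  \<comment> \<open>Either \<open>b\<close> moves \<open>m\<close> little, or \<open>m\<close>,
    \<open>b m\<close> and \<open>b (a (b m))\<close> lie almost in line, so that the product of
    \<open>b\<close> and \<open>a\<close> behaves at \<open>m\<close> like a translation by about
    \<open>E\<close>.\<close>
  have "E \<le> 4 * C + 10 * \<delta> + 8 \<or> 2 * E - C - 2 * \<delta> - 2 \<le> d m (b (a (b m)))"
  proof -
    have "d (b x) (b (a x)) + d m (b m)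
        \<le> max (d (b x) m + d (b (a x)) (b m)) (d (b x) (b m) + d (b (a x)) m) + \<delta>"
      "d (b (a x)) m + d (b (a (b m))) (b m)
        \<le> max (d (b (a x)) (b (a (b m))) + d m (b m)) (d (b (a x)) (b m) + d m (b (a (b m)))) + \<delta>"
      using in_M by (auto intro!: four_point)
    moreover have "d (b (a m)) (b (a (b m))) \<le> d (b (a m)) (b m) + d (b m) (b (a (b m)))"
      using in_M by (auto intro!: triangle)
    ultimately show ?thesis
      using iso ma am xbm bxm \<delta> C E E_def commute[of "b (a x)" "b m"] commute[of "b x" "b m"]
        commute[of "b (a (b m))" "b m"] commute[of "b (a m)" "b m"] commute[of m x]
      by linarith
  qed
  \<comment> \<open>The almost fixed point \<open>r\<close> of the product excludes the translation
    through \<open>square_displacement\<close>. Exchanging \<open>m\<close> and \<open>a m\<close>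
    costs \<open>C\<close> at each of two places.\<close>
  moreover have "d m (b (a (b m))) \<le> E + 2 * C + 3 * L + \<delta>"
  proof -
    have "d m (b (a (b (a m)))) \<le> d m (b (a m)) + 3 * L + \<delta>"
      using square_displacement[OF isometric_comp[OF b a], of r L m] r m(1) by simp
    moreover have "d m (b (a (b m))) \<le> d m (b (a (b (a m)))) + d (b (a (b (a m)))) (b (a (b m)))"
      "d m (b (a m)) \<le> d m (b m) + d (b m) (b (a m))"
      using in_M by (auto intro!: triangle)
    ultimately show ?thesis
      using iso am E_def commute[of "b (a (b (a m)))" "b (a (b m))"] by linarith
  qed
  ultimately show ?thesis
    using L \<delta> C_def E_def by linarith
qed

text \<open>A coarse form of Serre's lemma on isometries of trees. With \<open>i\<close> chosen to
  have the largest displacement at \<open>x\<close>, the rough midpoint \<open>m\<close> of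
  \<open>x\<close> and \<open>f i x\<close> depends on no other index, and
  \<open>pair_displacement\<close> applies to \<open>f i\<close> and every \<open>f j\<close> at
  this same \<open>m\<close>.\<close>

lemma common_displacement:
  assumes "finite I" "M \<noteq> {}"
    and iso: "\<And>i. i \<in> I \<Longrightarrow> isometric (f i)"
    and single: "\<And>i. i \<in> I \<Longrightarrow> \<exists>p\<in>M. d p (f i p) \<le> L"
    and pair: "\<And>i j. i \<in> I \<Longrightarrow> j \<in> I \<Longrightarrow> \<exists>p\<in>M. d p (f i (f j p)) \<le> L"
  shows "\<exists>m\<in>M. \<forall>i\<in>I. d m (f i m) \<le> 21 * L + 32 * \<delta> + 32"
proof (cases "I = {}")
  case False
  obtain x where x: "x \<in> M" using assms by auto
  define h where "h i = d x (f i x)" for i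
  have "Max (h ` I) \<in> h ` I" using assms(1) False by (intro Max_in) auto
  then obtain i where i: "i \<in> I" "h i = Max (h ` I)" by auto
  have max: "d x (f j x) \<le> d x (f i x)" if "j \<in> I" for j
    using Max_ge[of "h ` I" "h j"] i(2) assms(1) that by (simp add: h_def)
  obtain m where m: "m \<in> M" "d x m \<le> d x (f i x) / 2 + 1" "d m (f i x) \<le> d x (f i x) / 2 + 1"
    using rough_midpoint[OF x, of "f i x"] iso[OF i(1)] x by auto
  have "d m (f j m) \<le> 21 * L + 32 * \<delta> + 32" if j: "j \<in> I" for j
    using single[OF i(1)] single[OF j] pair[OF j i(1)]
      pair_displacement[OF iso[OF i(1)] iso[OF j] _ _ _ _ _ _ x max[OF j] m] by blast
  then show ?thesis using m(1) by blast
qed (use assms in auto)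

end

section \<open>Word metrics\<close>

lemma conjugate_refl:
  assumes "group G" "x \<in> carrier G"
  shows "conjugate G x x"
proof -
  interpret group G by fact
  show ?thesis using assms(2) unfolding conjugate_def by (intro bexI[of _ "\<one>\<^bsub>G\<^esub>"]) auto
qed

lemma conjugate_sym:
  assumes "group G" "x \<in> carrier G" "conjugate G x y"
  shows "conjugate G y x"
proof -
  interpret group G by fact
  obtain g where g: "g \<in> carrier G" "y = g \<otimes>\<^bsub>G\<^esub> x \<otimes>\<^bsub>G\<^esub> inv\<^bsub>G\<^esub> g"
    using assms(3) unfolding conjugate_def by auto
  then have "x = inv\<^bsub>G\<^esub> g \<otimes>\<^bsub>G\<^esub> y \<otimes>\<^bsub>G\<^esub> inv\<^bsub>G\<^esub> (inv\<^bsub>G\<^esub> g)"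
    using assms(2) by (simp add: m_assoc) (simp flip: m_assoc)
  then show ?thesis using g(1) unfolding conjugate_def by blast
qed

lemma conjugate_trans:
  assumes "group G" "x \<in> carrier G" "conjugate G x y" "conjugate G y z"
  shows "conjugate G x z"
proof -
  interpret group G by fact
  obtain g h where g: "g \<in> carrier G" "y = g \<otimes>\<^bsub>G\<^esub> x \<otimes>\<^bsub>G\<^esub> inv\<^bsub>G\<^esub> g"
    and h: "h \<in> carrier G" "z = h \<otimes>\<^bsub>G\<^esub> y \<otimes>\<^bsub>G\<^esub> inv\<^bsub>G\<^esub> h"
    using assms(3,4) unfolding conjugate_def by auto
  then have "z = (h \<otimes>\<^bsub>G\<^esub> g) \<otimes>\<^bsub>G\<^esub> x \<otimes>\<^bsub>G\<^esub> inv\<^bsub>G\<^esub> (h \<otimes>\<^bsub>G\<^esub> g)"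
    using assms(2) by (simp add: m_assoc inv_mult_group)
  then show ?thesis using g(1) h(1) unfolding conjugate_def by blast
qed

lemma finite_image_factor:
  assumes "finite (h ` A)" "\<And>x y. x \<in> A \<Longrightarrow> y \<in> A \<Longrightarrow> h x = h y \<Longrightarrow> f x = f y"
  shows "finite (f ` A)"
proof (rule finite_subset)
  show "f ` A \<subseteq> (\<lambda>e. f (inv_into A h e)) ` (h ` A)"
  proof
    fix y assume "y \<in> f ` A"
    then obtain x where x: "x \<in> A" "y = f x" by auto
    then have "f x = f (inv_into A h (h x))"
      by (intro assms(2)) (auto intro: inv_into_into simp: f_inv_into_f)
    then show "y \<in> (\<lambda>e. f (inv_into A h e)) ` (h ` A)" using x by blast
  qed
qed (use assms(1) in blast)

text \<open>The map \<open>h\<close> labels elements so that equal labels force equal cosets. It may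
  be any map, which allows labels read off chosen representatives.\<close>

lemma (in group) finite_rcosets:
  assumes "subgroup K G" "finite (h ` carrier G)"
    "\<And>x y. x \<in> carrier G \<Longrightarrow> y \<in> carrier G \<Longrightarrow> h x = h y \<Longrightarrow> x \<otimes> inv y \<in> K"
  shows "finite (rcosets K)"
proof -
  have "rcosets K = (\<lambda>x. K #> x) ` carrier G" by (auto simp: RCOSETS_def)
  moreover have "finite ((\<lambda>x. K #> x) ` carrier G)"
  proof (rule finite_image_factor[OF assms(2)])
    fix x y assume xy: "x \<in> carrier G" "y \<in> carrier G" "h x = h y"
    have "x \<in> K #> y"
      using subgroup.rcos_module_rev[OF assms(1) group_axioms xy(2,1)] assms(3)[OF xy] by blast
    then show "K #> x = K #> y" using repr_independence[OF _ xy(2) assms(1)] by simp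
  qed
  ultimately show ?thesis by simp
qed

section \<open>Words in a finite generating set\<close>

locale finitely_generated_group = group G for G (structure) +
  fixes S
  assumes finite_S: "finite S" and generating: "symmetric_generating_set G S"
begin

lemma S_subset: "S \<subseteq> carrier G"
  using generating by (simp add: symmetric_generating_set_def)

lemma word_closed: "set ws \<subseteq> S \<Longrightarrow> foldr (\<otimes>) ws \<one> \<in> carrier G"
  using S_subset by (induction ws) auto

lemma word_append:
  "set us \<subseteq> S \<Longrightarrow> set vs \<subseteq> S \<Longrightarrow>
   foldr (\<otimes>) (us @ vs) \<one> = foldr (\<otimes>) us \<one> \<otimes> foldr (\<otimes>) vs \<one>"
proof (induction us)
  case (Cons u us)
  then have "u \<in> carrier G" using S_subset by auto
  then show ?case using Cons word_closed[of us] word_closed[of vs] by (simp add: m_assoc)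
qed (simp add: word_closed)

lemma ex_word:
  assumes "g \<in> carrier G"
  shows "\<exists>ws. set ws \<subseteq> S \<and> foldr (\<otimes>) ws \<one> = g"
proof -
  have "g \<in> generate G S" using assms generating by (simp add: symmetric_generating_set_def)
  then show ?thesis
  proof induction
    case one
    show ?case by (intro exI[of _ "[]"]) simp
  next
    case (incl h)
    then show ?case using S_subset by (intro exI[of _ "[h]"]) auto
  next
    case (inv h)
    then show ?case using S_subset generating
      by (intro exI[of _ "[inv h]"]) (auto simp: symmetric_generating_set_def)
  next
    case (eng h1 h2)
    then obtain us vs where "set us \<subseteq> S" "foldr (\<otimes>) us \<one> = h1" "set vs \<subseteq> S" "foldr (\<otimes>) vs \<one> = h2"
      by blast
    then show ?case by (intro exI[of _ "us @ vs"]) (simp add: word_append del: foldr_append)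
  qed
qed

lemma word_length_le: "set ws \<subseteq> S \<Longrightarrow> word_length G S (foldr (\<otimes>) ws \<one>) \<le> length ws"
  unfolding word_length_def by (rule Least_le) blast

lemma ex_shortest_word:
  assumes "g \<in> carrier G"
  shows "\<exists>ws. set ws \<subseteq> S \<and> length ws = word_length G S g \<and> foldr (\<otimes>) ws \<one> = g"
  using LeastI_ex[of "\<lambda>n. \<exists>ws. set ws \<subseteq> S \<and> length ws = n \<and> foldr (\<otimes>) ws \<one> = g"] ex_word[OF assms]
  unfolding word_length_def by blast

lemma finite_word_ball: "finite {g \<in> carrier G. word_length G S g \<le> n}"
proof (rule finite_subset)
  show "{g \<in> carrier G. word_length G S g \<le> n}
      \<subseteq> (\<lambda>ws. foldr (\<otimes>) ws \<one>) ` {ws. set ws \<subseteq> S \<and> length ws \<le> n}"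
    using ex_shortest_word by fastforce
qed (simp add: finite_lists_length_le finite_S)

lemma word_length_generator: "s \<in> S \<Longrightarrow> word_length G S s \<le> 1"
  using word_length_le[of "[s]"] S_subset by auto

lemma word_length_generator_mult: "s \<in> S \<Longrightarrow> t \<in> S \<Longrightarrow> word_length G S (s \<otimes> t) \<le> 2"
  using word_length_le[of "[s, t]"] S_subset by auto

lemma word_dist_left_mult:
  assumes "g \<in> carrier G" "x \<in> carrier G" "y \<in> carrier G"
  shows "word_dist G S (g \<otimes> x) (g \<otimes> y) = word_dist G S x y"
proof -
  have "inv g \<otimes> (g \<otimes> y) = y" using assms by (simp flip: m_assoc)
  then show ?thesis using assms by (simp add: word_dist_def inv_mult_group m_assoc)
qed

text \<open>A shortest word for \<open>inv x \<otimes> y\<close> is cut in half; the summand 1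
  absorbs the rounding of an odd length.\<close>

lemma word_dist_midpoint:
  assumes "x \<in> carrier G" "y \<in> carrier G"
  shows "\<exists>m\<in>carrier G. real (word_dist G S x m) \<le> real (word_dist G S x y) / 2 + 1 \<and>
    real (word_dist G S m y) \<le> real (word_dist G S x y) / 2 + 1"
proof -
  obtain ws where ws: "set ws \<subseteq> S" "length ws = word_dist G S x y" "foldr (\<otimes>) ws \<one> = inv x \<otimes> y"
    using ex_shortest_word[of "inv x \<otimes> y"] assms by (auto simp: word_dist_def)
  define us vs where "us = take (length ws div 2) ws" and "vs = drop (length ws div 2) ws"
  define u v where "u = foldr (\<otimes>) us \<one>" and "v = foldr (\<otimes>) vs \<one>"
  have S: "set us \<subseteq> S" "set vs \<subseteq> S"
    using ws(1) set_take_subset set_drop_subset unfolding us_def vs_def by fast+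
  then have uv: "u \<in> carrier G" "v \<in> carrier G" by (auto simp: u_def v_def word_closed)
  have uv_eq: "u \<otimes> v = inv x \<otimes> y"
    using word_append[OF S] ws(3) by (simp add: u_def v_def us_def vs_def flip: foldr_append)
  have "inv u \<otimes> (inv x \<otimes> y) = v" unfolding uv_eq[symmetric] using uv by (simp flip: m_assoc)
  then have "word_dist G S (x \<otimes> u) y = word_length G S v"
    using uv assms unfolding word_dist_def by (simp add: inv_mult_group m_assoc)
  moreover have "word_dist G S x (x \<otimes> u) = word_length G S u"
    using uv assms unfolding word_dist_def by (simp flip: m_assoc)
  moreover have "word_length G S u \<le> length ws div 2" "word_length G S v \<le> length ws - length ws div 2"
    using word_length_le[OF S(1)] word_length_le[OF S(2)] by (auto simp: u_def v_def us_def vs_def)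
  ultimately show ?thesis using uv assms ws(2) by (intro bexI[of _ "x \<otimes> u"]) auto
qed

lemma hom_eqI:
  assumes Q: "group Q" and f: "f \<in> hom G Q" and h: "h \<in> hom G Q"
    and eq: "\<And>s. s \<in> S \<Longrightarrow> f s = h s" and g: "g \<in> carrier G"
  shows "f g = h g"
proof -
  have *: "f (foldr (\<otimes>) ws \<one>) = h (foldr (\<otimes>) ws \<one>)" if "set ws \<subseteq> S" for ws
    using that
  proof (induction ws)
    case Nil
    then show ?case using hom_one[OF f group_axioms Q] hom_one[OF h group_axioms Q] by simp
  next
    case (Cons w ws)
    then show ?case
      using S_subset word_closed[of ws] eq hom_mult[OF f] hom_mult[OF h] by auto
  qed
  then show ?thesis using ex_word[OF g] by blast
qed

text \<open>A homomorphism is determined by its values on \<open>S\<close>, and extensionality turns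
  this into equality of functions. The set \<open>B\<close> is left free to serve two cases: a ball
  of the word metric in \<open>G\<close>, and the whole of a finite group.\<close>

lemma finite_hom:
  assumes Q: "group Q" and B: "finite B"
  shows "finite {f \<in> hom G Q \<inter> extensional (carrier G). f ` S \<subseteq> B}"
proof (rule finite_imageD)
  show "finite ((\<lambda>f. restrict f S) ` {f \<in> hom G Q \<inter> extensional (carrier G). f ` S \<subseteq> B})"
  proof (rule finite_subset)
    show "(\<lambda>f. restrict f S) ` {f \<in> hom G Q \<inter> extensional (carrier G). f ` S \<subseteq> B} \<subseteq> S \<rightarrow>\<^sub>E B"
      by auto
  qed (simp add: finite_PiE finite_S B)
  show "inj_on (\<lambda>f. restrict f S) {f \<in> hom G Q \<inter> extensional (carrier G). f ` S \<subseteq> B}"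
  proof (rule inj_onI)
    fix f h
    assume f: "f \<in> {f \<in> hom G Q \<inter> extensional (carrier G). f ` S \<subseteq> B}"
      and h: "h \<in> {f \<in> hom G Q \<inter> extensional (carrier G). f ` S \<subseteq> B}"
      and eq: "restrict f S = restrict h S"
    have "f s = h s" if "s \<in> S" for s using fun_cong[OF eq, of s] that by simp
    then have "f g = h g" if "g \<in> carrier G" for g
      using hom_eqI[OF Q, of f h g] f h that by blast
    then show "f = h" using f h by (intro extensionalityI[of f "carrier G"]) auto
  qed
qed

end

section \<open>Vertices of the Cayley graph and the action by left multiplication\<close>

definition vertex :: "'a \<Rightarrow> 'a \<Rightarrow> real" where
  "vertex u = (\<lambda>g. if g = u then 1 else 0)"

lemma supp_vertex [simp]: "supp (vertex u) = {u}"
  by (auto simp: supp_def vertex_def)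

lemma vertex_in_cayley_graph: "u \<in> carrier G \<Longrightarrow> vertex u \<in> cayley_graph G S"
  by (simp add: cayley_graph_def) (auto simp: vertex_def)

lemma vertex_eq_iff [simp]: "vertex u = vertex v \<longleftrightarrow> u = v"
  by (metis supp_vertex singleton_inject)

text \<open>Distinct vertices have incomparable singleton supports, so the minimum has a single
  candidate. For \<open>u = v\<close> the branch for a common edge gives 0, in agreement with the
  empty word.\<close>

lemma (in finitely_generated_group) cayley_dist_vertex:
  assumes "u \<in> carrier G" "v \<in> carrier G"
  shows "cayley_dist G S (vertex u) (vertex v) = real (word_dist G S u v)"
proof (cases "u = v")
  case True
  then show ?thesis
    using assms word_length_le[of "[]"] by (simp add: cayley_dist_def word_dist_def)
next
  case False
  then show ?thesis
    using assms by (auto simp: cayley_dist_def vertex_in_cayley_graph) (simp add: vertex_def)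
qed

locale hyperbolic_cayley_graph = finitely_generated_group +
  fixes \<delta>
  assumes hyperbolic: "hyperbolic_space \<delta> (cayley_graph G S) (cayley_dist G S)"
begin

text \<open>The displacement argument runs on the group itself, where left multiplication acts by
  isometries. The metric axioms and the constant \<open>6 * \<delta> + 2\<close> are inherited from
  the Cayley graph along \<open>vertex\<close>; halved words supply the midpoints.\<close>

sublocale vertices: four_point_space "carrier G" "\<lambda>u v. cayley_dist G S (vertex u) (vertex v)" "6 * \<delta> + 2"
proof -
  interpret X: Metric_space "cayley_graph G S" "cayley_dist G S"
    by (rule hyperbolic_spaceD(1)[OF hyperbolic])
  show "four_point_space (carrier G) (\<lambda>u v. cayley_dist G S (vertex u) (vertex v)) (6 * \<delta> + 2)"
  proof
    fix x y z w assume "x \<in> carrier G" "y \<in> carrier G" "z \<in> carrier G" "w \<in> carrier G"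
    then show "cayley_dist G S (vertex x) (vertex y) + cayley_dist G S (vertex z) (vertex w)
      \<le> max (cayley_dist G S (vertex x) (vertex z) + cayley_dist G S (vertex y) (vertex w))
          (cayley_dist G S (vertex x) (vertex w) + cayley_dist G S (vertex y) (vertex z)) + (6 * \<delta> + 2)"
      by (intro hyperbolic_space_four_point[OF hyperbolic] vertex_in_cayley_graph)
  next
    fix x y assume "x \<in> carrier G" "y \<in> carrier G"
    then show "\<exists>m\<in>carrier G. cayley_dist G S (vertex x) (vertex m) \<le> cayley_dist G S (vertex x) (vertex y) / 2 + 1 \<and>
        cayley_dist G S (vertex m) (vertex y) \<le> cayley_dist G S (vertex x) (vertex y) / 2 + 1"
      using word_dist_midpoint[of x y] by (auto simp: cayley_dist_vertex)
  next
    fix x y show "cayley_dist G S (vertex x) (vertex y) = cayley_dist G S (vertex y) (vertex x)"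
      by (rule X.commute)
  next
    fix x y z assume "x \<in> carrier G" "y \<in> carrier G" "z \<in> carrier G"
    then show "cayley_dist G S (vertex x) (vertex z)
        \<le> cayley_dist G S (vertex x) (vertex y) + cayley_dist G S (vertex y) (vertex z)"
      by (intro X.triangle vertex_in_cayley_graph)
  qed (simp_all add: vertex_in_cayley_graph)
qed

lemma isometric_left_mult: "g \<in> carrier G \<Longrightarrow> vertices.isometric ((\<otimes>) g)"
  unfolding vertices.isometric_def by (simp add: cayley_dist_vertex word_dist_left_mult)

text \<open>If \<open>k\<close> conjugates \<open>g\<close> to \<open>h\<close>, then
  \<open>inv k \<otimes> h \<otimes> k = g\<close>, so left multiplication by \<open>h\<close> moves
  \<open>k\<close> exactly by the length of \<open>g\<close>, however long the conjugator
  is.\<close>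

lemma displacement_conjugate:
  assumes "g \<in> carrier G" "conjugate G g h"
  shows "\<exists>p\<in>carrier G. cayley_dist G S (vertex p) (vertex (h \<otimes> p)) \<le> word_length G S g"
proof -
  obtain k where k: "k \<in> carrier G" "h = k \<otimes> g \<otimes> inv k"
    using assms(2) unfolding conjugate_def by auto
  have "inv k \<otimes> (h \<otimes> k) = (inv k \<otimes> k) \<otimes> g \<otimes> (inv k \<otimes> k)"
    unfolding k(2) using k(1) assms(1) by (simp only: m_assoc m_closed inv_closed)
  then have "word_dist G S k (h \<otimes> k) = word_length G S g"
    using k(1) assms(1) by (simp add: word_dist_def)
  moreover have "h \<in> carrier G" using k assms(1) by simp
  ultimately show ?thesis using k(1) by (intro bexI[of _ k]) (simp_all add: cayley_dist_vertex)
qed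

(* The bound depends only on the Cayley graph because f s and f (s t) are conjugate to s and s t,
   so all of them have displacement at most 2. *)
lemma ex_short_conjugates:
  "\<exists>n. \<forall>f\<in>hom G G. (\<forall>g\<in>carrier G. conjugate G g (f g)) \<longrightarrow>
    (\<exists>x\<in>carrier G. \<forall>s\<in>S. word_length G S (inv x \<otimes> f s \<otimes> x) \<le> n)"
proof -
  \<comment> \<open>The bound of \<open>common_displacement\<close> for \<open>L = 2\<close> and
    four-point constant \<open>6 * \<delta> + 2\<close>.\<close>
  define K where "K = 21 * 2 + 32 * (6 * \<delta> + 2) + 32"
  have "\<exists>x\<in>carrier G. \<forall>s\<in>S. word_length G S (inv x \<otimes> f s \<otimes> x) \<le> nat \<lfloor>K\<rfloor>"
    if f: "f \<in> hom G G" "\<forall>g\<in>carrier G. conjugate G g (f g)" for f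
  proof -
    have fS: "f s \<in> carrier G" "s \<in> carrier G" if "s \<in> S" for s
      using S_subset hom_in_carrier[OF f(1)] that by blast+
    have "\<exists>m\<in>carrier G. \<forall>s\<in>S. cayley_dist G S (vertex m) (vertex (f s \<otimes> m)) \<le> K"
      unfolding K_def
    proof (rule vertices.common_displacement[OF finite_S])
      fix s assume s: "s \<in> S"
      show "vertices.isometric ((\<otimes>) (f s))" using isometric_left_mult fS s by blast
      obtain p where p: "p \<in> carrier G"
        "cayley_dist G S (vertex p) (vertex (f s \<otimes> p)) \<le> real (word_length G S s)"
        using displacement_conjugate[of s "f s"] f(2) fS s by blast
      then show "\<exists>p\<in>carrier G. cayley_dist G S (vertex p) (vertex (f s \<otimes> p)) \<le> 2"
        using word_length_generator[OF s] by (intro bexI[of _ p]) auto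
      fix t assume t: "t \<in> S"
      have "conjugate G (s \<otimes> t) (f s \<otimes> f t)"
        using f(2) hom_mult[OF f(1)] fS s t by (metis m_closed)
      then obtain p where p: "p \<in> carrier G"
        "cayley_dist G S (vertex p) (vertex (f s \<otimes> f t \<otimes> p)) \<le> real (word_length G S (s \<otimes> t))"
        using displacement_conjugate[of "s \<otimes> t" "f s \<otimes> f t"] fS s t by blast
      then show "\<exists>p\<in>carrier G. cayley_dist G S (vertex p) (vertex (f s \<otimes> (f t \<otimes> p))) \<le> 2"
        using word_length_generator_mult[OF s t] fS s t by (intro bexI[of _ p]) (auto simp: m_assoc)
    qed auto
    then obtain m where m: "m \<in> carrier G"
      "\<And>s. s \<in> S \<Longrightarrow> cayley_dist G S (vertex m) (vertex (f s \<otimes> m)) \<le> K" by blast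
    \<comment> \<open>The displacement of \<open>m\<close> under \<open>f s\<close> is the length of
      \<open>inv m \<otimes> f s \<otimes> m\<close>, so a common almost fixed point is a common
      conjugator.\<close>
    have "word_length G S (inv m \<otimes> f s \<otimes> m) \<le> nat \<lfloor>K\<rfloor>" if "s \<in> S" for s
      using m(2)[OF that] m(1) fS[OF that]
      by (simp add: cayley_dist_vertex word_dist_def m_assoc le_nat_floor)
    then show ?thesis using m(1) by blast
  qed
  then show ?thesis by blast
qed

end

section \<open>Outer automorphisms\<close>

definition inner_aut :: "('a, 'b) monoid_scheme \<Rightarrow> 'a \<Rightarrow> 'a \<Rightarrow> 'a" where
  "inner_aut G g = (\<lambda>x\<in>carrier G. g \<otimes>\<^bsub>G\<^esub> x \<otimes>\<^bsub>G\<^esub> inv\<^bsub>G\<^esub> g)"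

lemma Inn_eq: "Inn G = inner_aut G ` carrier G"
  by (simp add: Inn_def inner_aut_def image_def)

definition class_preserving :: "('a, 'b) monoid_scheme \<Rightarrow> ('a \<Rightarrow> 'a) set" where
  "class_preserving G = {f \<in> auto G. \<forall>g\<in>carrier G. conjugate G g (f g)}"

lemma carrier_AutoGroup [simp]: "carrier (AutoGroup G) = auto G"
  by (simp add: AutoGroup_def)

lemma AutoGroup_mult:
  "f \<in> auto G \<Longrightarrow> h \<in> auto G \<Longrightarrow> f \<otimes>\<^bsub>AutoGroup G\<^esub> h = compose (carrier G) f h"
  by (simp add: AutoGroup_def BijGroup_def auto_def)

lemma AutoGroup_one: "\<one>\<^bsub>AutoGroup G\<^esub> = (\<lambda>x\<in>carrier G. x)"
  by (simp add: AutoGroup_def BijGroup_def)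

lemma auto_hom: "f \<in> auto G \<Longrightarrow> f \<in> hom G G"
  by (simp add: auto_def)

lemma auto_extensional: "f \<in> auto G \<Longrightarrow> f \<in> extensional (carrier G)"
  by (simp add: auto_def Bij_def)

lemma auto_in_carrier: "f \<in> auto G \<Longrightarrow> x \<in> carrier G \<Longrightarrow> f x \<in> carrier G"
  by (rule hom_in_carrier[OF auto_hom])

context group
begin

lemma AutoGroup_inv_apply:
  assumes "f \<in> auto G" "x \<in> carrier G"
  shows "inv\<^bsub>AutoGroup G\<^esub> f \<in> auto G" "f ((inv\<^bsub>AutoGroup G\<^esub> f) x) = x"
proof -
  interpret A: group "AutoGroup G" by (rule AutoGroup)
  show inv: "inv\<^bsub>AutoGroup G\<^esub> f \<in> auto G" using A.inv_closed[of f] assms(1) by simp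
  have "compose (carrier G) f (inv\<^bsub>AutoGroup G\<^esub> f) = (\<lambda>x\<in>carrier G. x)"
    using A.r_inv[of f] assms(1) inv by (simp add: AutoGroup_mult AutoGroup_one)
  from fun_cong[OF this, of x] show "f ((inv\<^bsub>AutoGroup G\<^esub> f) x) = x"
    using assms(2) by (simp add: compose_def)
qed

lemma inner_aut_comp:
  assumes "g \<in> carrier G" "h \<in> carrier G"
  shows "compose (carrier G) (inner_aut G g) (inner_aut G h) = inner_aut G (g \<otimes> h)"
  using assms by (auto simp: compose_def inner_aut_def inv_mult_group m_assoc intro!: restrict_ext)

lemma inner_aut_one: "inner_aut G \<one> = (\<lambda>x\<in>carrier G. x)"
  by (auto simp: inner_aut_def intro!: restrict_ext)

lemma inner_aut_auto:
  assumes g: "g \<in> carrier G"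
  shows "inner_aut G g \<in> auto G"
proof -
  have "inner_aut G g \<in> hom G G"
  proof (rule homI)
    fix x y assume "x \<in> carrier G" "y \<in> carrier G"
    moreover from this have "inv g \<otimes> (g \<otimes> (y \<otimes> inv g)) = y \<otimes> inv g"
      using g by (simp flip: m_assoc)
    ultimately show "inner_aut G g (x \<otimes> y) = inner_aut G g x \<otimes> inner_aut G g y"
      using g by (simp add: inner_aut_def m_assoc)
  qed (use g in \<open>auto simp: inner_aut_def\<close>)
  moreover have "bij_betw (inner_aut G g) (carrier G) (carrier G)"
  proof (rule bij_betw_byWitness[where f' = "inner_aut G (inv g)"])
    have *: "inner_aut G g (inner_aut G h x) = x" if "g \<in> carrier G" "h \<in> carrier G" "g \<otimes> h = \<one>" "x \<in> carrier G" for g h x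
      using fun_cong[OF inner_aut_comp[of g h], of x] that by (simp add: inner_aut_one compose_def)
    show "\<forall>x\<in>carrier G. inner_aut G (inv g) (inner_aut G g x) = x" "\<forall>x\<in>carrier G. inner_aut G g (inner_aut G (inv g) x) = x"
      using * g by auto
  qed (use g in \<open>auto simp: inner_aut_def\<close>)
  ultimately show ?thesis by (simp add: auto_def Bij_def inner_aut_def)
qed

lemma auto_comp_inner_aut:
  assumes f: "f \<in> auto G" and g: "g \<in> carrier G"
  shows "compose (carrier G) f (inner_aut G g) = compose (carrier G) (inner_aut G (f g)) f"
proof -
  interpret f: group_hom G G f
    using auto_hom[OF f] by unfold_locales
  show ?thesis
    using g unfolding compose_def inner_aut_def by (intro restrict_ext) auto
qed

text \<open>Conjugating \<open>inner_aut G g\<close> by an automorphism \<open>f\<close> gives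
  \<open>inner_aut G (f g)\<close>.\<close>

lemma Inn_normal: "Inn G \<lhd> AutoGroup G"
proof -
  interpret A: group "AutoGroup G" by (rule AutoGroup)
  have mult: "inner_aut G g \<otimes>\<^bsub>AutoGroup G\<^esub> inner_aut G h = inner_aut G (g \<otimes> h)"
    if "g \<in> carrier G" "h \<in> carrier G" for g h
    using that by (simp add: AutoGroup_mult inner_aut_auto inner_aut_comp)
  have inv: "inv\<^bsub>AutoGroup G\<^esub> (inner_aut G g) = inner_aut G (inv g)" if "g \<in> carrier G" for g
    using that by (intro A.inv_equality) (auto simp: mult inner_aut_auto inner_aut_one AutoGroup_one)
  have "subgroup (Inn G) (AutoGroup G)"
    by (rule A.subgroupI) (auto simp: Inn_eq inner_aut_auto inv mult)
  moreover have "f \<otimes>\<^bsub>AutoGroup G\<^esub> inner_aut G g \<otimes>\<^bsub>AutoGroup G\<^esub> inv\<^bsub>AutoGroup G\<^esub> f \<in> Inn G"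
    if f: "f \<in> auto G" and g: "g \<in> carrier G" for f g
  proof -
    have "f \<otimes>\<^bsub>AutoGroup G\<^esub> inner_aut G g = inner_aut G (f g) \<otimes>\<^bsub>AutoGroup G\<^esub> f"
      using f g by (simp add: AutoGroup_mult inner_aut_auto auto_comp_inner_aut auto_in_carrier)
    then have "f \<otimes>\<^bsub>AutoGroup G\<^esub> inner_aut G g \<otimes>\<^bsub>AutoGroup G\<^esub> inv\<^bsub>AutoGroup G\<^esub> f = inner_aut G (f g)"
      using f g inner_aut_auto[of "f g"] A.inv_closed[of f] by (simp add: A.m_assoc auto_in_carrier)
    then show ?thesis using auto_in_carrier[OF f g] by (simp add: Inn_eq)
  qed
  ultimately show ?thesis unfolding A.normal_inv_iff by (auto simp: Inn_eq)
qed

lemma group_Out: "group (Out G)"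
  unfolding Out_def by (rule normal.factorgroup_is_group[OF Inn_normal])

lemma Out_proj_hom: "(\<lambda>f. Inn G #>\<^bsub>AutoGroup G\<^esub> f) \<in> hom (AutoGroup G) (Out G)"
  unfolding Out_def by (rule normal.r_coset_hom_Mod[OF Inn_normal])

lemma carrier_Out: "carrier (Out G) = (\<lambda>f. Inn G #>\<^bsub>AutoGroup G\<^esub> f) ` auto G"
  unfolding Out_def by (auto simp: FactGroup_def RCOSETS_def)

section \<open>Class-preserving automorphisms and their torsion classes in
  \<open>Out G\<close>\<close>

lemma class_preserving_comp:
  assumes f: "f \<in> class_preserving G" and h: "h \<in> class_preserving G"
  shows "f \<otimes>\<^bsub>AutoGroup G\<^esub> h \<in> class_preserving G"
proof -
  interpret A: group "AutoGroup G" by (rule AutoGroup)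
  have a: "f \<in> auto G" "h \<in> auto G" using f h by (auto simp: class_preserving_def)
  have "conjugate G g (f (h g))" if "g \<in> carrier G" for g
  proof (rule conjugate_trans[OF group_axioms that])
    show "conjugate G g (h g)" "conjugate G (h g) (f (h g))"
      using f h auto_in_carrier[OF a(2) that] that by (simp_all add: class_preserving_def)
  qed
  then show ?thesis
    using a A.m_closed[of f h] by (auto simp: class_preserving_def AutoGroup_mult compose_def)
qed

lemma class_preserving_one: "\<one>\<^bsub>AutoGroup G\<^esub> \<in> class_preserving G"
  using id_in_auto by (auto simp: class_preserving_def AutoGroup_one intro: conjugate_refl[OF group_axioms])

end

lemma (in hyperbolic_cayley_graph) finite_class_preserving_Out:
  "finite ((\<lambda>f. Inn G #>\<^bsub>AutoGroup G\<^esub> f) ` class_preserving G)"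
proof -
  interpret A: group "AutoGroup G" by (rule AutoGroup)
  obtain n where n: "\<And>f. \<lbrakk>f \<in> hom G G; \<forall>g\<in>carrier G. conjugate G g (f g)\<rbrakk> \<Longrightarrow>
      \<exists>x\<in>carrier G. \<forall>s\<in>S. word_length G S (inv x \<otimes> f s \<otimes> x) \<le> n"
    using ex_short_conjugates by blast
  define B where "B = {g \<in> carrier G. word_length G S g \<le> n}"
  \<comment> \<open>\<open>F\<close> may contain homomorphisms that are not bijective; it is finite,
    and its cosets cover those of the class-preserving automorphisms.\<close>
  define F where "F = {f \<in> hom G G \<inter> extensional (carrier G). f ` S \<subseteq> B}"
  have "finite F" unfolding F_def B_def by (rule finite_hom[OF group_axioms finite_word_ball])
  moreover have "(\<lambda>f. Inn G #>\<^bsub>AutoGroup G\<^esub> f) ` class_preserving G \<subseteq> (\<lambda>f. Inn G #>\<^bsub>AutoGroup G\<^esub> f) ` F"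
  proof
    fix X assume "X \<in> (\<lambda>f. Inn G #>\<^bsub>AutoGroup G\<^esub> f) ` class_preserving G"
    then obtain f where f: "f \<in> auto G" "\<forall>g\<in>carrier G. conjugate G g (f g)"
        and X: "X = Inn G #>\<^bsub>AutoGroup G\<^esub> f"
      by (auto simp: class_preserving_def)
    obtain x where x: "x \<in> carrier G" "\<forall>s\<in>S. word_length G S (inv x \<otimes> f s \<otimes> x) \<le> n"
      using n[OF auto_hom[OF f(1)] f(2)] by blast
    \<comment> \<open>Composing with an inner automorphism keeps the coset and carries every
      generator into the ball \<open>B\<close>.\<close>
    define h where "h = inner_aut G (inv x) \<otimes>\<^bsub>AutoGroup G\<^esub> f"
    have h: "h \<in> auto G"
      unfolding h_def using A.m_closed[of "inner_aut G (inv x)" f] f(1) x(1) inner_aut_auto by simp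
    have hs: "h s = inv x \<otimes> f s \<otimes> x" if "s \<in> carrier G" for s
    proof -
      have "h = compose (carrier G) (inner_aut G (inv x)) f"
        using x(1) f(1) by (simp add: h_def AutoGroup_mult inner_aut_auto)
      then show ?thesis
        using that x(1) f(1) by (simp add: compose_def inner_aut_def auto_in_carrier)
    qed
    have "h s \<in> B" if "s \<in> S" for s
    proof -
      have s: "s \<in> carrier G" using S_subset that by blast
      then show ?thesis using hs[OF s] x that auto_in_carrier[OF h s] by (simp add: B_def)
    qed
    then have "h \<in> F" using auto_hom[OF h] auto_extensional[OF h] by (auto simp: F_def)
    moreover have "h \<in> Inn G #>\<^bsub>AutoGroup G\<^esub> f"
      unfolding h_def r_coset_def using x(1) by (auto simp: Inn_eq)
    then have "X = Inn G #>\<^bsub>AutoGroup G\<^esub> h"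
      unfolding X using A.repr_independence[of h "Inn G" f] f(1) Inn_normal normal_imp_subgroup by auto
    ultimately show "X \<in> (\<lambda>f. Inn G #>\<^bsub>AutoGroup G\<^esub> f) ` F" by blast
  qed
  ultimately show ?thesis by (meson finite_imageI finite_subset)
qed

text \<open>Two powers coincide by the pigeonhole principle, and cancellation leaves a trivial
  positive power.\<close>

lemma (in group) finite_powers_torsion:
  assumes x: "x \<in> carrier G" and fin: "finite F" and pow: "\<And>n::nat. x [^] n \<in> F"
  shows "\<exists>n>0. x [^] (n::nat) = \<one>"
proof -
  have "\<not> inj (\<lambda>n::nat. x [^] n)"
    using fin pow finite_subset[of "range (\<lambda>n::nat. x [^] n)" F] range_inj_infinite by blast
  then obtain m n :: nat where "m < n" "x [^] m = x [^] n"
    by (metis injI nat_neq_iff)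
  then show ?thesis
    using pow_eq_div2[OF x, of n m] by (intro exI[of _ "n - m"]) auto
qed

text \<open>All powers of \<open>f\<close> are class-preserving, so their cosets stay in the finite
  set of \<open>finite_class_preserving_Out\<close>.\<close>

lemma (in hyperbolic_cayley_graph) class_preserving_torsion:
  assumes f: "f \<in> class_preserving G"
  shows "\<exists>n>0. (Inn G #>\<^bsub>AutoGroup G\<^esub> f) [^]\<^bsub>Out G\<^esub> (n::nat) = \<one>\<^bsub>Out G\<^esub>"
proof (rule group.finite_powers_torsion[OF group_Out _ finite_class_preserving_Out])
  interpret A: group "AutoGroup G" by (rule AutoGroup)
  have a: "f \<in> auto G" using f by (simp add: class_preserving_def)
  then show "Inn G #>\<^bsub>AutoGroup G\<^esub> f \<in> carrier (Out G)" by (auto simp: carrier_Out)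
  fix n :: nat
  interpret p: group_hom "AutoGroup G" "Out G" "\<lambda>f. Inn G #>\<^bsub>AutoGroup G\<^esub> f"
    by (intro group_hom.intro group_hom_axioms.intro AutoGroup group_Out Out_proj_hom)
  have "f [^]\<^bsub>AutoGroup G\<^esub> n \<in> class_preserving G"
    by (induction n) (auto simp: class_preserving_one class_preserving_comp f)
  then show "(Inn G #>\<^bsub>AutoGroup G\<^esub> f) [^]\<^bsub>Out G\<^esub> n \<in> (\<lambda>f. Inn G #>\<^bsub>AutoGroup G\<^esub> f) ` class_preserving G"
    using p.hom_nat_pow[of f n] a by auto
qed

(* Grossman's argument.  Testing conjugacy in Q against all homomorphisms from G to Q, rather than
   against one quotient map, makes this a subgroup without passing to a characteristic kernel. *)
definition locally_inner :: "('a, 'b) monoid_scheme \<Rightarrow> ('c, 'd) monoid_scheme \<Rightarrow> ('a \<Rightarrow> 'a) set" where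
  "locally_inner G Q = {f \<in> auto G. \<forall>h\<in>hom G Q. \<forall>x\<in>carrier G. conjugate Q (h x) (h (f x))}"

section \<open>Automorphisms that a finite group cannot distinguish from inner ones\<close>

lemma (in group) locally_inner_subgroup:
  assumes Q: "group Q"
  shows "subgroup (locally_inner G Q) (AutoGroup G)"
proof -
  interpret A: group "AutoGroup G" by (rule AutoGroup)
  show ?thesis
  proof (rule A.subgroupI)
    have "conjugate Q (h x) (h x)" if "h \<in> hom G Q" "x \<in> carrier G" for h x
      by (rule conjugate_refl[OF Q hom_in_carrier[OF that]])
    then have "\<one>\<^bsub>AutoGroup G\<^esub> \<in> locally_inner G Q"
      using id_in_auto by (simp add: locally_inner_def AutoGroup_one)
    then show "locally_inner G Q \<noteq> {}" by blast
  next
    fix f assume f: "f \<in> locally_inner G Q"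
    then have a: "f \<in> auto G" by (simp add: locally_inner_def)
    have i: "inv\<^bsub>AutoGroup G\<^esub> f \<in> auto G" using A.inv_closed[of f] a by simp
    have "conjugate Q (h x) (h ((inv\<^bsub>AutoGroup G\<^esub> f) x))" if "h \<in> hom G Q" "x \<in> carrier G" for h x
    proof -
      \<comment> \<open>The condition on \<open>f\<close> is applied at the preimage of
        \<open>x\<close>; symmetry of conjugacy then reverses it.\<close>
      have y: "(inv\<^bsub>AutoGroup G\<^esub> f) x \<in> carrier G" using auto_in_carrier[OF i that(2)] .
      then have "conjugate Q (h ((inv\<^bsub>AutoGroup G\<^esub> f) x)) (h (f ((inv\<^bsub>AutoGroup G\<^esub> f) x)))"
        using f that(1) by (simp add: locally_inner_def)
      then have "conjugate Q (h ((inv\<^bsub>AutoGroup G\<^esub> f) x)) (h x)"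
        using AutoGroup_inv_apply(2)[OF a that(2)] by simp
      then show ?thesis by (rule conjugate_sym[OF Q hom_in_carrier[OF that(1) y]])
    qed
    then show "inv\<^bsub>AutoGroup G\<^esub> f \<in> locally_inner G Q" using i by (simp add: locally_inner_def)
  next
    fix f k assume f: "f \<in> locally_inner G Q" and k: "k \<in> locally_inner G Q"
    then have a: "f \<in> auto G" "k \<in> auto G" by (auto simp: locally_inner_def)
    have "conjugate Q (h x) (h (f (k x)))" if "h \<in> hom G Q" "x \<in> carrier G" for h x
    proof (rule conjugate_trans[OF Q hom_in_carrier[OF that]])
      show "conjugate Q (h x) (h (k x))" "conjugate Q (h (k x)) (h (f (k x)))"
        using f k that auto_in_carrier[OF a(2) that(2)] by (simp_all add: locally_inner_def)
    qed
    then show "f \<otimes>\<^bsub>AutoGroup G\<^esub> k \<in> locally_inner G Q"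
      using a A.m_closed[of f k] by (auto simp: locally_inner_def AutoGroup_mult compose_def)
  qed (auto simp: locally_inner_def)
qed

text \<open>A homomorphism \<open>h\<close> carries the conjugator \<open>g\<close> to the
  conjugator \<open>h g\<close>. Hence membership in \<open>locally_inner G Q\<close> depends only
  on the class in \<open>Out G\<close>.\<close>

lemma (in group) Inn_locally_inner:
  assumes Q: "group Q"
  shows "Inn G \<subseteq> locally_inner G Q"
proof
  fix f assume "f \<in> Inn G"
  then obtain g where g: "g \<in> carrier G" "f = inner_aut G g" by (auto simp: Inn_eq)
  have "conjugate Q (h x) (h (f x))" if h: "h \<in> hom G Q" and x: "x \<in> carrier G" for h x
  proof -
    interpret h: group_hom G Q h by (intro group_hom.intro group_hom_axioms.intro group_axioms Q h)
    show ?thesis using g x unfolding conjugate_def by (intro bexI[of _ "h g"]) (auto simp: inner_aut_def)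
  qed
  then show "f \<in> locally_inner G Q" using g inner_aut_auto by (simp add: locally_inner_def)
qed

text \<open>\<open>D f\<close> records how precomposition with \<open>f\<close> acts on the finite
  set of homomorphisms from \<open>G\<close> to \<open>Q\<close>. If \<open>f\<close> and
  \<open>k\<close> act alike, then \<open>f\<close> after the inverse of \<open>k\<close> fixes
  every such homomorphism, so it satisfies the conjugacy condition with equality.\<close>

lemma (in finitely_generated_group) ex_finite_invariant:
  assumes Q: "group Q" and fin: "finite (carrier Q)"
  shows "\<exists>D :: ('a \<Rightarrow> 'a) \<Rightarrow> ('a \<Rightarrow> 'c) \<Rightarrow> 'a \<Rightarrow> 'c. finite (D ` auto G) \<and>
    (\<forall>f\<in>auto G. \<forall>k\<in>auto G. D f = D k \<longrightarrow> f \<otimes>\<^bsub>AutoGroup G\<^esub> inv\<^bsub>AutoGroup G\<^esub> k \<in> locally_inner G (Q :: ('c, 'd) monoid_scheme))"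
proof -
  interpret A: group "AutoGroup G" by (rule AutoGroup)
  define HQ where "HQ = hom G Q \<inter> extensional (carrier G)"
  have "HQ = {f \<in> hom G Q \<inter> extensional (carrier G). f ` S \<subseteq> carrier Q}"
    using S_subset by (auto simp: HQ_def hom_def Pi_iff)
  then have finHQ: "finite HQ" using finite_hom[OF Q fin] by simp
  define D where "D f = (\<lambda>h\<in>HQ. compose (carrier G) h f)" for f
  have "compose (carrier G) h f \<in> HQ" if "f \<in> auto G" "h \<in> HQ" for f h
    using hom_compose[OF auto_hom[OF that(1)], of h Q] that(2) by (simp add: HQ_def)
  then have "D ` auto G \<subseteq> HQ \<rightarrow>\<^sub>E HQ" by (simp add: D_def image_subset_iff)
  then have "finite (D ` auto G)"
    by (rule finite_subset) (simp add: finite_PiE finHQ)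
  moreover have "f \<otimes>\<^bsub>AutoGroup G\<^esub> inv\<^bsub>AutoGroup G\<^esub> k \<in> locally_inner G Q"
    if f: "f \<in> auto G" and k: "k \<in> auto G" and eq: "D f = D k" for f k
  proof -
    have i: "inv\<^bsub>AutoGroup G\<^esub> k \<in> auto G" using A.inv_closed[of k] k by simp
    have fi: "f \<otimes>\<^bsub>AutoGroup G\<^esub> inv\<^bsub>AutoGroup G\<^esub> k \<in> auto G" using A.m_closed[of f] f i by simp
    have same: "h (f y) = h (k y)" if h: "h \<in> hom G Q" and y: "y \<in> carrier G" for h y
    proof -
      \<comment> \<open>Members of \<open>hom G Q\<close> are arbitrary off the carrier, so
        \<open>h\<close> is restricted before it is compared within \<open>HQ\<close>.\<close>
      have "restrict h (carrier G) \<in> HQ" using h by (simp add: HQ_def hom_def Pi_iff)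
      then have "compose (carrier G) (restrict h (carrier G)) f = compose (carrier G) (restrict h (carrier G)) k"
        using fun_cong[OF eq, of "restrict h (carrier G)"] by (simp add: D_def)
      from fun_cong[OF this, of y] show ?thesis
        using y f k by (simp add: compose_def auto_in_carrier)
    qed
    have fixed: "h ((f \<otimes>\<^bsub>AutoGroup G\<^esub> inv\<^bsub>AutoGroup G\<^esub> k) x) = h x"
      if "h \<in> hom G Q" "x \<in> carrier G" for h x
      using same[OF that(1) auto_in_carrier[OF i that(2)]] AutoGroup_inv_apply(2)[OF k that(2)]
        that(2) f i by (simp add: AutoGroup_mult compose_def)
    have "conjugate Q (h x) (h ((f \<otimes>\<^bsub>AutoGroup G\<^esub> inv\<^bsub>AutoGroup G\<^esub> k) x))"
      if "h \<in> hom G Q" "x \<in> carrier G" for h x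
      unfolding fixed[OF that] by (rule conjugate_refl[OF Q hom_in_carrier[OF that]])
    then show ?thesis using fi by (simp add: locally_inner_def)
  qed
  ultimately show ?thesis by blast
qed

section \<open>Separation in \<open>Out G\<close> and residual finiteness\<close>

lemma (in group) not_class_preserving_not_locally_inner:
  assumes "conjugacy_separable G" "f \<in> auto G" "f \<notin> class_preserving G"
  shows "\<exists>Q :: 'a set monoid. group Q \<and> finite (carrier Q) \<and> f \<notin> locally_inner G Q"
proof -
  obtain g where g: "g \<in> carrier G" "\<not> conjugate G g (f g)"
    using assms(2,3) by (auto simp: class_preserving_def)
  then obtain N where N: "N \<lhd> G" "finite (carrier (G Mod N))" "\<not> conjugate (G Mod N) (N #> g) (N #> f g)"
    using assms(1) auto_in_carrier[OF assms(2)] unfolding conjugacy_separable_def by blast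
  \<comment> \<open>The quotient map itself is the homomorphism that violates the condition at
    \<open>g\<close>.\<close>
  have "(\<lambda>x. N #> x) \<in> hom G (G Mod N)" by (rule normal.r_coset_hom_Mod[OF N(1)])
  then have "f \<notin> locally_inner G (G Mod N)" using N(3) g(1) by (auto simp: locally_inner_def)
  then show ?thesis using N normal.factorgroup_is_group[OF N(1)] by blast
qed

text \<open>The subgroup is the intersection of \<open>H\<close> with the image in
  \<open>Out G\<close> of \<open>locally_inner G Q\<close>, for a finite quotient \<open>Q\<close>
  that detects \<open>f\<close>.\<close>

lemma (in finitely_generated_group) finite_index_avoiding:
  assumes sep: "conjugacy_separable G" and H: "subgroup H (Out G)"
    and f: "f \<in> auto G" "f \<notin> class_preserving G"
  shows "\<exists>K. finite_index_subgroup K ((Out G)\<lparr>carrier := H\<rparr>) \<and> Inn G #>\<^bsub>AutoGroup G\<^esub> f \<notin> K"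
proof -
  interpret A: group "AutoGroup G" by (rule AutoGroup)
  interpret O: group "Out G" by (rule group_Out)
  interpret OH: group "(Out G)\<lparr>carrier := H\<rparr>" by (rule O.subgroup_imp_group[OF H])
  define p where "p f = Inn G #>\<^bsub>AutoGroup G\<^esub> f" for f
  interpret p: group_hom "AutoGroup G" "Out G" p
    using Out_proj_hom unfolding p_def[abs_def]
    by (intro group_hom.intro group_hom_axioms.intro AutoGroup group_Out)
  obtain Q :: "'a set monoid" where Q: "group Q" "finite (carrier Q)" "f \<notin> locally_inner G Q"
    using not_class_preserving_not_locally_inner[OF sep f] by blast
  define L where "L = locally_inner G Q"
  have L: "subgroup L (AutoGroup G)" unfolding L_def by (rule locally_inner_subgroup[OF Q(1)])
  obtain D :: "('a \<Rightarrow> 'a) \<Rightarrow> ('a \<Rightarrow> 'a set) \<Rightarrow> 'a \<Rightarrow> 'a set" where D: "finite (D ` auto G)"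
    "\<And>f k. f \<in> auto G \<Longrightarrow> k \<in> auto G \<Longrightarrow> D f = D k \<Longrightarrow> f \<otimes>\<^bsub>AutoGroup G\<^esub> inv\<^bsub>AutoGroup G\<^esub> k \<in> L"
    using ex_finite_invariant[OF Q(1,2)] unfolding L_def by blast
  have sub: "subgroup (p ` L \<inter> H) (Out G)"
    by (rule O.subgroups_Inter_pair[OF p.subgroup_img_is_subgroup[OF L] H])
  have subH: "subgroup (p ` L \<inter> H) ((Out G)\<lparr>carrier := H\<rparr>)"
    by (rule O.subgroup_incl[OF sub H]) simp
  have rep: "\<exists>f\<in>auto G. X = p f" if "X \<in> H" for X
    using that subgroup.subset[OF H] by (auto simp: carrier_Out p_def)
  \<comment> \<open>A representative automorphism is chosen for each class in \<open>H\<close>;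
    \<open>D\<close> of it labels the cosets with finitely many values.\<close>
  define r where "r X = (SOME f. f \<in> auto G \<and> X = p f)" for X
  have r: "r X \<in> auto G" "p (r X) = X" if "X \<in> H" for X
    using someI_ex[of "\<lambda>f. f \<in> auto G \<and> X = p f"] rep[OF that] unfolding r_def by auto
  have "finite (rcosets\<^bsub>(Out G)\<lparr>carrier := H\<rparr>\<^esub> (p ` L \<inter> H))"
  proof (rule OH.finite_rcosets[OF subH])
    have "(\<lambda>X. D (r X)) ` H \<subseteq> D ` auto G" using r(1) by blast
    then show "finite ((\<lambda>X. D (r X)) ` carrier ((Out G)\<lparr>carrier := H\<rparr>))"
      using D(1) finite_subset by simp
    fix X Y assume XY: "X \<in> carrier ((Out G)\<lparr>carrier := H\<rparr>)" "Y \<in> carrier ((Out G)\<lparr>carrier := H\<rparr>)"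
      and eq: "D (r X) = D (r Y)"
    then have "p (r X \<otimes>\<^bsub>AutoGroup G\<^esub> inv\<^bsub>AutoGroup G\<^esub> r Y) = X \<otimes>\<^bsub>Out G\<^esub> inv\<^bsub>Out G\<^esub> Y"
      using r[of X] r[of Y] A.inv_closed[of "r Y"] by simp
    moreover have "r X \<otimes>\<^bsub>AutoGroup G\<^esub> inv\<^bsub>AutoGroup G\<^esub> r Y \<in> L"
      using D(2) r XY eq by simp
    moreover have "X \<otimes>\<^bsub>Out G\<^esub> inv\<^bsub>Out G\<^esub> Y \<in> H"
      using XY subgroup.m_closed[OF H] subgroup.m_inv_closed[OF H] by simp
    ultimately show "X \<otimes>\<^bsub>(Out G)\<lparr>carrier := H\<rparr>\<^esub> inv\<^bsub>(Out G)\<lparr>carrier := H\<rparr>\<^esub> Y \<in> p ` L \<inter> H"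
      using XY O.m_inv_consistent[OF H] by (auto intro: rev_image_eqI)
  qed
  \<comment> \<open>Since \<open>L\<close> contains \<open>Inn G\<close>, it is a union of cosets,
    so passing to \<open>Out G\<close> cannot bring \<open>f\<close> into it.\<close>
  moreover have "p f \<notin> p ` L"
  proof
    assume "p f \<in> p ` L"
    then obtain k where k: "k \<in> L" "p f = p k" by auto
    have ka: "k \<in> auto G" using k(1) by (simp add: L_def locally_inner_def)
    have "f \<in> Inn G #>\<^bsub>AutoGroup G\<^esub> k"
      using A.repr_independenceD[of "Inn G" f k] k(2) f(1) normal_imp_subgroup[OF Inn_normal]
      by (simp add: p_def)
    then obtain i where i: "i \<in> Inn G" "f = i \<otimes>\<^bsub>AutoGroup G\<^esub> k" by (auto simp: r_coset_def)
    then have "i \<in> L" using Inn_locally_inner[OF Q(1)] by (auto simp: L_def)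
    then have "f \<in> L" using i(2) k(1) subgroup.m_closed[OF L] by simp
    then show False using Q(3) by (simp add: L_def)
  qed
  ultimately show ?thesis
    using subH unfolding finite_index_subgroup_def p_def by blast
qed

theorem theorem2p3:
  fixes G :: "('a, 'b) monoid_scheme"
  assumes "group G"
    and "conjugacy_separable G"
    and "hyperbolic_group G"
    and "subgroup H (Out G)"
    and "virtually_torsion_free ((Out G)\<lparr>carrier := H\<rparr>)"
  shows "residually_finite ((Out G)\<lparr>carrier := H\<rparr>)"
proof -
  obtain S \<delta> where S: "finite S" "symmetric_generating_set G S"
    "hyperbolic_space \<delta> (cayley_graph G S) (cayley_dist G S)"
    using assms(3) unfolding hyperbolic_group_def by blast
  interpret hyperbolic_cayley_graph G S \<delta>
    by (intro hyperbolic_cayley_graph.intro finitely_generated_group.intro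
        finitely_generated_group_axioms.intro hyperbolic_cayley_graph_axioms.intro assms(1) S)
  let ?OH = "(Out G)\<lparr>carrier := H\<rparr>"
  interpret O: group "Out G" by (rule group_Out)
  interpret OH: group ?OH by (rule O.subgroup_imp_group[OF assms(4)])
  obtain T where T: "finite_index_subgroup T ?OH" "torsion_free (?OH\<lparr>carrier := T\<rparr>)"
    using assms(5) unfolding virtually_torsion_free_def by blast
  have "X = \<one>\<^bsub>Out G\<^esub>" if X: "\<And>K. finite_index_subgroup K ?OH \<Longrightarrow> X \<in> K" for X
  proof -
    \<comment> \<open>\<open>T\<close> is itself one of the finite-index subgroups containing
      \<open>X\<close>, so it is enough to show that \<open>X\<close> is torsion.\<close>
    have XT: "X \<in> T" using X T(1) by blast
    moreover have "T \<subseteq> H" using T(1) subgroup.subset unfolding finite_index_subgroup_def by fastforce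
    ultimately have "X \<in> carrier (Out G)" using subgroup.subset[OF assms(4)] by blast
    then obtain f where f: "f \<in> auto G" "X = Inn G #>\<^bsub>AutoGroup G\<^esub> f" by (auto simp: carrier_Out)
    \<comment> \<open>Otherwise \<open>finite_index_avoiding\<close> would supply a finite-index
      subgroup of \<open>H\<close> without \<open>X\<close>.\<close>
    then have "f \<in> class_preserving G"
      using finite_index_avoiding[OF assms(2,4)] X by blast
    then obtain n :: nat where n: "n > 0" "X [^]\<^bsub>Out G\<^esub> n = \<one>\<^bsub>Out G\<^esub>"
      using class_preserving_torsion f(2) by blast
    have "X [^]\<^bsub>?OH\<lparr>carrier := T\<rparr>\<^esub> n = X [^]\<^bsub>Out G\<^esub> n" by (simp add: nat_pow_def)
    then show ?thesis using T(2) XT n unfolding torsion_free_def by auto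
  qed
  moreover have "\<one>\<^bsub>Out G\<^esub> \<in> K" if "finite_index_subgroup K ?OH" for K
    using that subgroup.one_closed unfolding finite_index_subgroup_def by fastforce
  ultimately show ?thesis unfolding residually_finite_def by auto
qed

end
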